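(* Let $\ell\ge 1$, let $V$ be any real $3\times \ell$ matrix, let $H=\mathrm{diag}(1,1,0)$, let $M\in SO(3)$ and let $\kappa\ge 0$ be real. Let $\mu$ be the Haar probability measure on $SO(3)$ and let $$f^{\mathrm{CAY}}_\kappa(A)=\frac{\sqrt{\pi}\,\Gamma(\kappa+2)}{2^{2\kappa}\,\Gamma(\kappa+1/2)}\,(1+\mathrm{tr}(A))^\kappa,\qquad A\in SO(3),$$ be the Cayley density with parameter $\kappa$. Then $$\int_{SO(3)} \mathrm{Gram}(HAV)\,f^{\mathrm{CAY}}_\kappa(AM^{\mathsf T})\,\mu(\mathrm{d}A)=\mathrm{Gram}(V)-\mathrm{Gram}(D^{\mathrm{CAY}}_\kappa MV),$$ where $$D^{\mathrm{CAY}}_\kappa=\mathrm{diag}\left(\sqrt{\frac{2(\kappa+1)}{6+5\kappa+\kappa^2}},\ \sqrt{\frac{2(\kappa+1)}{6+5\kappa+\kappa^2}},\ \sqrt{\frac{2+\kappa+\kappa^2}{6+5\kappa+\kappa^2}}\right).$$ Moreover, $D^{\mathrm{CAY}}_\kappa$ is a scalar matrix (all diagonal entries are identical) not only for $\kappa=0$, which corresponds to the Haar distribution $\mu$, but also for $\kappa=1$; hence the Cayley distribution with $\kappa=1$ fakes uniformity for the Gram matrix functional, that is, $$\int_{SO(3)} \mathrm{Gram}(HAV)\,f^{\mathrm{CAY}}_1(AM^{\mathsf T})\,\mu(\mathrm{d}A)=\int_{SO(3)} \mathrm{Gram}(HAV)\,\mu(\mathrm{d}A)=\tfrac23\,\m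athrm{Gram}(V).$$
   Context: For any real matrix $W$, $\mathrm{Gram}(W)=W^{\mathsf T}W$. $SO(3)$ is the group of real $3\times 3$ matrices $A$ with $A^{\mathsf T}A=I$ and $\det A=1$; $\mathrm{tr}$ is the trace and $\Gamma$ is the Gamma function. Integrals of matrix-valued functions are taken entrywise. The convention $0^0=1$ is used, so that $f^{\mathrm{CAY}}_0\equiv 1$. The function $f^{\mathrm{CAY}}_\kappa$ is the density with respect to $\mu$ of a random rotation $R$ (the Cayley distribution); $A\mapsto f^{\mathrm{CAY}}_\kappa(AM^{\mathsf T})$ is then the density of $P=RM$. *)

theory Defs
  imports "HOL-Analysis.Analysis" "HOL-Probability.Probability"
begin

definition Gram :: "real^'n^'m \<Rightarrow> real^'n^'n" where
  "Gram W = transpose W ** W"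

definition diag3 :: "real \<Rightarrow> real \<Rightarrow> real \<Rightarrow> real^3^3" where
  "diag3 a b c = (\<chi> i j. if i = j then (vector [a, b, c] :: real^3) $ i else 0)"

definition SO3 :: "(real^3^3) set" where
  "SO3 = {A. rotation_matrix A}"

text \<open>As SO(3) is compact, exactly one such measure exists, and it is also right invariant.\<close>

definition haar_prob_SO3 :: "(real^3^3) measure \<Rightarrow> bool" where
  "haar_prob_SO3 \<mu> \<longleftrightarrow>
     prob_space \<mu> \<and>
     sets \<mu> = sets (restrict_space borel SO3) \<and>
     (\<forall>B\<in>SO3. distr \<mu> \<mu> (\<lambda>A. B ** A) = \<mu>)"

definition matrix_integrable :: "'a measure \<Rightarrow> ('a \<Rightarrow> real^'n^'m) \<Rightarrow> bool" where
  "matrix_integrable \<mu> F \<longleftrightarrow> (\<forall>i j. integrable \<mu> (\<lambda>x. F x $ i $ j))"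

definition matrix_integral :: "'a measure \<Rightarrow> ('a \<Rightarrow> real^'n^'m) \<Rightarrow> real^'n^'m" where
  "matrix_integral \<mu> F = (\<chi> i j. LINT x|\<mu>. F x $ i $ j)"

text \<open>Real powers with the convention $0^0 = 1$; the library has \<open>0 powr 0 = 0\<close>.\<close>

definition rpow :: "real \<Rightarrow> real \<Rightarrow> real" where
  "rpow x a = (if a = 0 then 1 else x powr a)"

text \<open>On SO(3) the base \<open>1 + trace A\<close> is nonnegative.\<close>

definition cayley_density :: "real \<Rightarrow> real^3^3 \<Rightarrow> real" where
  "cayley_density \<kappa> A =
     sqrt pi * Gamma (\<kappa> + 2) / (2 powr (2 * \<kappa>) * Gamma (\<kappa> + 1/2)) * rpow (1 + trace A) \<kappa>"

definition D_cayley :: "real \<Rightarrow> real^3^3" where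
  "D_cayley \<kappa> = diag3
     (sqrt (2 * (\<kappa> + 1) / (6 + 5 * \<kappa> + \<kappa>\<^sup>2)))
     (sqrt (2 * (\<kappa> + 1) / (6 + 5 * \<kappa> + \<kappa>\<^sup>2)))
     (sqrt ((2 + \<kappa> + \<kappa>\<^sup>2) / (6 + 5 * \<kappa> + \<kappa>\<^sup>2)))"

definition is_scalar_matrix :: "real^'n^'n \<Rightarrow> bool" where
  "is_scalar_matrix A \<longleftrightarrow> (\<exists>c. A = mat c)"

end

theory Submission imports Defs begin

text \<open>Write \<open>A = R M\<close> with \<open>R\<close> distributed by the Cayley density, and \<open>U = M V\<close>. As rotations preserve Gram
matrices and \<open>H\<close> deletes the last row, \<open>Gram (H A V)\<close> is \<open>Gram V\<close> minus the Gram matrix of the single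
row \<open>r U\<close>, where \<open>r\<close> is the third row of \<open>R\<close>. Everything therefore reduces to the matrix of second
moments of \<open>r\<close>. The density depends on the trace only, so the law of \<open>R\<close> is invariant under
conjugation; conjugating with half turns and a quarter turn about the coordinate axes shows that
this matrix is of the form \<open>diag(a, a, b)\<close> (lemmas \<open>row_moment_offdiag\<close> and \<open>row_moment_symmetric\<close>),
and \<open>2 a + b = 1\<close> because \<open>r\<close> is a unit vector and the density has total mass \<open>1\<close>. It remains to compute
this mass and \<open>2 a\<close>.

For this the Haar measure is described by quaternions. A nonzero \<open>q = (w, x, y, z)\<close> acts as a rotation
\<open>R(q)\<close>, every rotation arises, and \<open>R(q) R(p) = R(q p)\<close>. Multiplication by a unit quaternion being an
isometry of four-dimensional space, every finite measure in \<open>q\<close> with a radial density is sent to a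
multiple of the Haar measure (\<open>haar_quat_integral\<close>). In these coordinates
\<open>1 + trace R(q) = 4 w\<^sup>2 / |q|\<^sup>2\<close>, and the sum of the squares of the first two entries of \<open>r\<close> is
\<open>4 (w\<^sup>2 + z\<^sup>2) (x\<^sup>2 + y\<^sup>2) / |q|\<^sup>4\<close>. A Gaussian times a power of the norm, the power chosen to cancel the
denominators, leaves integrals of monomials against a Gaussian. These factor into one-dimensional
Gamma integrals (\<open>gaussian_moment_monomial\<close>), while the total mass of the weight is a radial Gamma
integral (\<open>gaussian_moment\<close>). The quotients are \<open>1\<close> and \<open>2 a = 4 (\<kappa> + 1) / ((\<kappa> + 2) (\<kappa> + 3))\<close>.

The equation \<open>a = b\<close> reads \<open>2 (\<kappa> + 1) = 2 + \<kappa> + \<kappa>\<^sup>2\<close>, so it holds for \<open>\<kappa> = 0\<close> and \<open>\<kappa> = 1\<close>; in both cases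
\<open>a = 1/3\<close>, and the integral is two thirds of \<open>Gram V\<close>.\<close>

section \<open>Rotations and quaternions\<close>

lemma vector_4 [simp]:
 "(vector [w,x,y,z] ::('a::zero)^4)$1 = w"
 "(vector [w,x,y,z] ::('a::zero)^4)$2 = x"
 "(vector [w,x,y,z] ::('a::zero)^4)$3 = y"
 "(vector [w,x,y,z] ::('a::zero)^4)$4 = z"
  unfolding vector_def by simp_all

text \<open>Quaternions \<open>w + x i + y j + z k\<close> are vectors of \<^typ>\<open>real^4\<close> with coordinates in this order.
The matrix below is that of \<open>v \<mapsto> q v q\<^sup>*\<close> on the imaginary quaternions; dividing it by the
squared norm of \<open>q\<close> turns it into a rotation for every \<open>q \<noteq> 0\<close>. The division is preferred to a
restriction to unit quaternions, because then all integrals can be taken against Lebesgue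
measure with an arbitrary radial weight.\<close>

definition quat_matrix :: "real^4 \<Rightarrow> real^3^3" where
  "quat_matrix q = (let w = q$1; x = q$2; y = q$3; z = q$4 in vector
     [vector [w\<^sup>2 + x\<^sup>2 - y\<^sup>2 - z\<^sup>2, 2 * (x * y - w * z), 2 * (x * z + w * y)],
      vector [2 * (x * y + w * z), w\<^sup>2 - x\<^sup>2 + y\<^sup>2 - z\<^sup>2, 2 * (y * z - w * x)],
      vector [2 * (x * z - w * y), 2 * (y * z + w * x), w\<^sup>2 - x\<^sup>2 - y\<^sup>2 + z\<^sup>2]])"

definition quat_rot :: "real^4 \<Rightarrow> real^3^3" where
  "quat_rot q = (1 / (norm q)\<^sup>2) *\<^sub>R quat_matrix q"

definition quat_mult :: "real^4 \<Rightarrow> real^4 \<Rightarrow> real^4" where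
  "quat_mult q p = vector
     [q$1 * p$1 - q$2 * p$2 - q$3 * p$3 - q$4 * p$4,
      q$1 * p$2 + q$2 * p$1 + q$3 * p$4 - q$4 * p$3,
      q$1 * p$3 - q$2 * p$4 + q$3 * p$1 + q$4 * p$2,
      q$1 * p$4 + q$2 * p$3 - q$3 * p$2 + q$4 * p$1]"

lemma norm_quat: "(norm (q::real^4))\<^sup>2 = (q$1)\<^sup>2 + (q$2)\<^sup>2 + (q$3)\<^sup>2 + (q$4)\<^sup>2"
  by (simp add: norm_vec_def L2_set_def sum_4 real_sqrt_pow2_iff)

lemma norm_quat_mult: "norm (quat_mult q p) = norm q * norm p"
proof -
  have "(norm (quat_mult q p))\<^sup>2 = (norm q * norm p)\<^sup>2"
    unfolding power_mult_distrib norm_quat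
    by (simp add: quat_mult_def power2_eq_square algebra_simps)
  then show ?thesis
    by (simp add: power2_eq_iff_nonneg)
qed

lemma quat_matrix_mult: "quat_matrix q ** quat_matrix p = quat_matrix (quat_mult q p)"
  by (simp add: vec_eq_iff forall_3 matrix_matrix_mult_def sum_3 quat_matrix_def Let_def quat_mult_def
      power2_eq_square algebra_simps)

lemma quat_rot_mult: "quat_rot q ** quat_rot p = quat_rot (quat_mult q p)"
  by (simp add: quat_rot_def norm_quat_mult quat_matrix_mult[symmetric] power_mult_distrib
      scalar_matrix_assoc[symmetric] matrix_scalar_ac)

lemma quat_rot_nth:
  fixes q :: "real^4"
  defines "N \<equiv> (norm q)\<^sup>2"
  shows "quat_rot q $ i $ j = quat_matrix q $ i $ j / N"
  by (simp add: quat_rot_def N_def)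

lemma quat_rot_in_SO3:
  assumes "q \<noteq> 0"
  shows "quat_rot q \<in> SO3"
proof -
  let ?P = "quat_matrix q" and ?N = "(norm q)\<^sup>2"
  have 1: "transpose ?P ** ?P = mat (?N * ?N)"
    unfolding norm_quat
    by (simp add: vec_eq_iff forall_3 matrix_matrix_mult_def sum_3 transpose_def mat_def quat_matrix_def Let_def
      power2_eq_square algebra_simps)
  have 2: "?P ** transpose ?P = mat (?N * ?N)"
    unfolding norm_quat
    by (simp add: vec_eq_iff forall_3 matrix_matrix_mult_def sum_3 transpose_def mat_def quat_matrix_def Let_def
      power2_eq_square algebra_simps)
  have 3: "det ?P = ?N ^ 3"
    unfolding norm_quat
    by (simp add: det_3 quat_matrix_def Let_def power2_eq_square power3_eq_cube algebra_simps)
  have N: "?N > 0" using assms by simp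
  have "orthogonal_matrix (quat_rot q)"
    unfolding orthogonal_matrix_def
    using N 1 2 assms
    by (simp add: quat_rot_def vec_eq_iff matrix_matrix_mult_def transpose_def mat_def
        sum_divide_distrib[symmetric] power2_eq_square)
  moreover have "det (quat_rot q) = 1"
    using N 3 by (simp add: quat_rot_def det_3 field_simps power3_eq_cube)
  ultimately show ?thesis by (simp add: SO3_def rotation_matrix_def)
qed

text \<open>This and the next lemma are the reason for passing to quaternions: the base of the Cayley power
becomes a single squared coordinate.\<close>

lemma trace_quat_rot: "q \<noteq> 0 \<Longrightarrow> 1 + trace (quat_rot q) = 4 * (q$1)\<^sup>2 / (norm q)\<^sup>2"
  by (simp add: trace_def sum_3 quat_rot_nth field_simps) (simp add: norm_quat quat_matrix_def Let_def algebra_simps)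

text \<open>A sum of products of squares is the convenient form of the second moments: its Gaussian
integral is a sum of products of one-dimensional integrals of nonnegative functions.\<close>

lemma quat_rot_third_row:
  "(quat_rot q $ 3 $ 1)\<^sup>2 + (quat_rot q $ 3 $ 2)\<^sup>2
     = 4 * ((q$1)\<^sup>2 + (q$4)\<^sup>2) * ((q$2)\<^sup>2 + (q$3)\<^sup>2) / ((norm q)\<^sup>2)\<^sup>2"
  by (simp add: quat_rot_nth power_divide add_divide_distrib[symmetric] quat_matrix_def Let_def)
    (simp add: power2_eq_square algebra_simps)

lemma SO3_mult: "A \<in> SO3 \<Longrightarrow> B \<in> SO3 \<Longrightarrow> A ** B \<in> SO3"
  by (simp add: SO3_def rotation_matrix_def orthogonal_matrix_mul det_mul)

lemma SO3_transpose: "A \<in> SO3 \<Longrightarrow> transpose A \<in> SO3"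
  by (simp add: SO3_def rotation_matrix_def det_transpose orthogonal_matrix_transpose)

lemma SO3_inverse: "A \<in> SO3 \<Longrightarrow> transpose A ** A = mat 1" "A \<in> SO3 \<Longrightarrow> A ** transpose A = mat 1"
  by (auto simp: SO3_def rotation_matrix_def orthogonal_matrix_def)

text \<open>Coordinate form of orthogonality and of the equality of a rotation with its cofactor matrix.
Together these polynomial equations suffice for the surjectivity of the quaternion map.\<close>

lemma SO3_equations:
  assumes "A \<in> SO3"
  shows "\<forall>i j. (\<Sum>k\<in>UNIV. A$k$i * A$k$j) = (if i = j then 1 else 0)"
    and "\<forall>i j. (\<Sum>k\<in>UNIV. A$i$k * A$j$k) = (if i = j then 1 else 0)"
    and "cross3 (column i A) (column j A) = A *v (cross3 (axis i 1) (axis j 1))"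
  using SO3_inverse[OF assms] cross_rotation_matrix[of A "axis i 1" "axis j 1"] assms
  by (auto simp: vec_eq_iff matrix_matrix_mult_def transpose_def mat_def SO3_def matrix_vector_mult_basis)

text \<open>If \<open>A\<close> is the rotation of a quaternion \<open>q\<close>, then \<open>1 + trace A\<close> and the three
independent entries of \<open>A - transpose A\<close> are the coordinates of \<open>q\<close> up to the common factor \<open>4 w / |q|\<^sup>2\<close>. So when
the trace is not \<open>-1\<close> these numbers are themselves the coordinates of a quaternion for \<open>A\<close>.\<close>

lemma quat_rot_surj_pos_trace:
  assumes A: "A \<in> SO3" and K: "1 + trace A > 0"
  shows "\<exists>q. q \<noteq> 0 \<and> quat_rot q = A"
proof -
  define K where "K = 1 + A$1$1 + A$2$2 + A$3$3"
  have "K > 0" using K by (simp add: K_def trace_def sum_3)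
  define q :: "real^4" where "q = vector [K, A$3$2 - A$2$3, A$1$3 - A$3$1, A$2$1 - A$1$2]"
  note c = SO3_equations(1,2)[OF A, unfolded forall_3 sum_3, simplified]
  note d = SO3_equations(3)[OF A, of 1 2] SO3_equations(3)[OF A, of 2 3] SO3_equations(3)[OF A, of 3 1]
  note d' = d[unfolded vec_eq_iff forall_3 cross3_def matrix_vector_mult_def column_def axis_def sum_3, simplified]
  \<comment> \<open>All components are polynomial identities modulo the equations \<open>c\<close> and \<open>d'\<close>.\<close>
  have N: "(norm q)\<^sup>2 = 4 * K"
    unfolding norm_quat q_def using c d' by (simp add: K_def) algebra
  have "quat_matrix q = (4 * K) *\<^sub>R A"
    by (simp add: vec_eq_iff forall_3 quat_matrix_def Let_def q_def)
      ((insert c d', unfold K_def, intro conjI); algebra)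
  then have "quat_rot q = A" using N \<open>K > 0\<close> by (simp add: quat_rot_def)
  moreover have "q \<noteq> 0" using N \<open>K > 0\<close> by auto
  ultimately show ?thesis by blast
qed

text \<open>Half turns about the coordinate axes are the rotations of the imaginary units. Multiplying by
them changes the sign of two diagonal entries at a time, and the four values of
\<open>1 + trace\<close> obtained in this way add up to \<open>4\<close>, so one of them is positive and the previous
lemma applies to it.\<close>

lemma quat_rot_surj:
  assumes A: "A \<in> SO3"
  shows "\<exists>q. q \<noteq> 0 \<and> quat_rot q = A"
proof -
  have turn: "\<exists>q. q \<noteq> 0 \<and> quat_rot q = A"
    if p: "norm p = 1" and K: "1 + trace (A ** transpose (quat_rot p)) > 0" for p
  proof -
    have P: "quat_rot p \<in> SO3" using p by (intro quat_rot_in_SO3) auto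
    obtain q where q: "q \<noteq> 0" "quat_rot q = A ** transpose (quat_rot p)"
      using quat_rot_surj_pos_trace[OF SO3_mult[OF A SO3_transpose[OF P]] K] by blast
    have "quat_rot (quat_mult q p) = A"
      by (simp add: quat_rot_mult[symmetric] q(2) matrix_mul_assoc[symmetric] SO3_inverse[OF P])
    moreover have "quat_mult q p \<noteq> 0"
      using q(1) p norm_quat_mult[of q p] by auto
    ultimately show ?thesis by blast
  qed
  have pos: "1 + A$1$1 + A$2$2 + A$3$3 > 0 \<or> 1 + A$1$1 - A$2$2 - A$3$3 > 0
      \<or> 1 - A$1$1 + A$2$2 - A$3$3 > 0 \<or> 1 - A$1$1 - A$2$2 + A$3$3 > 0"
    by linarith
  have n: "norm (axis i 1 :: real^4) = 1" for i by simp
  have t: "1 + trace (A ** transpose (quat_rot (axis 1 1))) = 1 + A$1$1 + A$2$2 + A$3$3"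
    "1 + trace (A ** transpose (quat_rot (axis 2 1))) = 1 + A$1$1 - A$2$2 - A$3$3"
    "1 + trace (A ** transpose (quat_rot (axis 3 1))) = 1 - A$1$1 + A$2$2 - A$3$3"
    "1 + trace (A ** transpose (quat_rot (axis 4 1))) = 1 - A$1$1 - A$2$2 + A$3$3"
    unfolding quat_rot_def n
    by (simp_all add: quat_matrix_def trace_def sum_3 matrix_matrix_mult_def transpose_def Let_def axis_def)
  show ?thesis
    using pos turn[OF n[of 1]] turn[OF n[of 2]] turn[OF n[of 3]] turn[OF n[of 4]] unfolding t by blast
qed

lemma quat_rot_scale: "c \<noteq> 0 \<Longrightarrow> quat_rot (c *\<^sub>R q) = quat_rot q"
proof -
  assume "c \<noteq> 0"
  have "quat_matrix (c *\<^sub>R q) = c\<^sup>2 *\<^sub>R quat_matrix q"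
    by (simp add: vec_eq_iff forall_3 quat_matrix_def Let_def power2_eq_square algebra_simps)
  then show ?thesis
    using \<open>c \<noteq> 0\<close> by (simp add: quat_rot_def power_mult_distrib)
qed

lemma quat_rot_surj_unit:
  assumes "A \<in> SO3"
  obtains p where "norm p = 1" "quat_rot p = A"
proof -
  obtain q where "q \<noteq> 0" "quat_rot q = A" using quat_rot_surj[OF assms] by blast
  then have "norm ((1 / norm q) *\<^sub>R q) = 1" "quat_rot ((1 / norm q) *\<^sub>R q) = A"
    using quat_rot_scale[of "1 / norm q" q] by simp_all
  then show ?thesis by (rule that)
qed

section \<open>Lebesgue measure under isometries and Gaussian moments\<close>

lemma lborel_distr_orthogonal:
  fixes T :: "real^'n::{finite,wellorder} \<Rightarrow> real^'n::_"
  assumes T: "orthogonal_transformation T"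
  shows "distr lborel borel T = lborel"
proof (rule sym, rule lborel_eqI)
  have "linear T" using T by (rule orthogonal_transformation_linear)
  then have [measurable]: "T \<in> borel_measurable borel"
    by (intro borel_measurable_continuous_onI linear_continuous_on linear_linear[THEN iffD2])
  fix l u :: "real^'n::_" assume lu: "\<And>b. b \<in> Basis \<Longrightarrow> l \<bullet> b \<le> u \<bullet> b"
  have eq: "T -` box l u = inv T ` box l u"
    using orthogonal_transformation_bij[OF T] by (simp add: bij_vimage_eq_inv_image)
  have T': "orthogonal_transformation (inv T)"
    using T by (rule orthogonal_transformation_inv)
  have "T -` box l u \<in> lmeasurable"
    unfolding eq by (intro measurable_orthogonal_image[OF T']) auto
  then have "emeasure lebesgue (T -` box l u) = measure lebesgue (T -` box l u)"
    by (simp add: emeasure_eq_measure2)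
  also have "\<dots> = measure lebesgue (box l u)"
    unfolding eq by (subst measure_orthogonal_image[OF T']) auto
  finally have "emeasure lebesgue (T -` box l u) = ennreal (measure lborel (box l u))"
    by simp
  moreover have "T -` box l u \<in> sets lborel"
    using measurable_sets[of T borel borel "box l u"] by simp
  ultimately have "emeasure lborel (T -` box l u) = ennreal (measure lborel (box l u))"
    by (simp add: emeasure_completion main_part_sets)
  then show "emeasure (distr lborel borel T) (box l u) = (\<Prod>b\<in>Basis. (u - l) \<bullet> b)"
    using lu by (simp add: emeasure_distr measure_lborel_box_eq)
qed simp

text \<open>Under Lebesgue measure in dimension \<open>n\<close>, the squared norm has distribution function
\<open>t \<mapsto> vol(B\<^sub>n) t powr (n/2)\<close>, by the volume formula for balls. This replaces polar coordinates.\<close>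

lemma distr_norm_power2:
  defines "n \<equiv> real DIM('a::euclidean_space)"
  shows "distr lborel borel (\<lambda>x::'a. (norm x)\<^sup>2) =
    density lborel (\<lambda>t. ennreal (indicator {0..} t * (unit_ball_vol n * n / 2 * t powr (n / 2 - 1))))"
    (is "?M = density lborel ?f")
proof (rule measure_eqI_generator_eq)
  let ?E = "range atMost :: real set set"
  have n: "n > 0" by (simp add: n_def)
  have M: "emeasure ?M {..t} = (if t < 0 then 0 else ennreal (unit_ball_vol n * t powr (n / 2)))" for t
  proof -
    have "emeasure ?M {..t} = emeasure lborel {x::'a. (norm x)\<^sup>2 \<le> t}"
      by (subst emeasure_distr) (auto intro!: arg_cong2[where f=emeasure])
    also have "\<dots> = (if t < 0 then 0 else ennreal (unit_ball_vol n * t powr (n / 2)))"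
    proof (cases "t < 0")
      case True
      then have "\<not> (norm x)\<^sup>2 \<le> t" for x :: 'a
        using zero_le_power2[of "norm x"] by linarith
      then have "{x::'a. (norm x)\<^sup>2 \<le> t} = {}" by blast
      then show ?thesis using True by simp
    next
      case False
      have "(norm x)\<^sup>2 \<le> t \<longleftrightarrow> norm x \<le> sqrt t" for x :: 'a
        using real_sqrt_le_iff[of "(norm x)\<^sup>2" t] by (simp only: real_sqrt_abs abs_norm_cancel)
      then have "{x::'a. (norm x)\<^sup>2 \<le> t} = cball 0 (sqrt t)"
        by (simp only: set_eq_iff mem_Collect_eq mem_cball_0 simp_thms)
      moreover have "sqrt t ^ DIM('a) = t powr (n / 2)"
      proof (cases "t = 0")
        case True
        then show ?thesis by simp
      next
        case t: False
        then have "sqrt t ^ DIM('a) = (t powr (1 / 2)) powr n"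
          unfolding n_def using False by (subst powr_realpow) (simp_all add: powr_half_sqrt)
        also have "\<dots> = t powr (n / 2)" by (simp only: powr_powr) simp
        finally show ?thesis .
      qed
      ultimately show ?thesis using False by (simp add: emeasure_cball n_def)
    qed
    finally show ?thesis .
  qed
  have N: "emeasure (density lborel ?f) {..t} = (if t < 0 then 0 else ennreal (unit_ball_vol n * t powr (n / 2)))" for t
  proof (cases "t < 0")
    case True
    have "emeasure (density lborel ?f) {..t} = (\<integral>\<^sup>+x. ?f x * indicator {..t} x \<partial>lborel)"
      by (subst emeasure_density) auto
    also have "\<dots> = integral\<^sup>N lborel (\<lambda>_::real. 0)"
      by (rule nn_integral_cong) (use True in \<open>auto simp: indicator_def\<close>)
    finally show ?thesis using True by simp
  next
    case False
    have "((\<lambda>x. unit_ball_vol n * n / 2 * x powr (n / 2 - 1)) has_integral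
            (unit_ball_vol n * n / 2 * (t powr (n / 2 - 1 + 1) / (n / 2 - 1 + 1)))) {0..t}"
      using False n by (intro has_integral_mult_right has_integral_powr_from_0) auto
    then have I: "((\<lambda>x. unit_ball_vol n * n / 2 * x powr (n / 2 - 1)) has_integral
            (unit_ball_vol n * t powr (n / 2))) {0..t}"
      using n by simp
    have "emeasure (density lborel ?f) {..t} =
        (\<integral>\<^sup>+x. indicator {0..t} x * (unit_ball_vol n * n / 2 * x powr (n / 2 - 1)) \<partial>lborel)"
      by (subst emeasure_density) (auto intro!: nn_integral_cong simp: indicator_def)
    also have "\<dots> = unit_ball_vol n * t powr (n / 2)"
      using n by (intro nn_integral_has_integral_lebesgue[OF _ I]) auto
    finally show ?thesis using False by simp
  qed
  show "Int_stable ?E" by (auto simp: Int_stable_def)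
  show "emeasure ?M X = emeasure (density lborel ?f) X" if "X \<in> ?E" for X
    using that M N by auto
  show "sets ?M = sigma_sets UNIV ?E"
    by (simp add: borel_eq_atMost)
  show "sets (density lborel ?f) = sigma_sets UNIV ?E"
    by (simp add: borel_eq_atMost)
  show "(\<Union>i::nat. {..real i}) = UNIV"
    using real_arch_simple by (auto simp: )
  show "emeasure ?M {..real i} \<noteq> \<infinity>" for i unfolding M by simp
qed auto

text \<open>Used in dimension \<open>4\<close> for the normalising constants and in dimension \<open>1\<close> for the coordinates.\<close>

lemma gaussian_moment:
  assumes s: "s \<ge> 0"
  defines "n \<equiv> real DIM('a::euclidean_space)"
  shows "(\<integral>\<^sup>+x. ennreal (rpow ((norm (x::'a))\<^sup>2) s * exp (- (norm x)\<^sup>2)) \<partial>lborel) =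
    ennreal (pi powr (n / 2) * Gamma (s + n / 2) / Gamma (n / 2))"
proof -
  have n: "n > 0" by (simp add: n_def)
  have [measurable]: "(\<lambda>t. rpow t s) \<in> borel_measurable borel"
    unfolding rpow_def by measurable
  define C where "C = unit_ball_vol n * n / 2"
  have "n / 2 \<notin> \<int>\<^sub>\<le>\<^sub>0"
    using n by (auto elim!: nonpos_Ints_cases)
  then have "Gamma (n / 2 + 1) = n / 2 * Gamma (n / 2)"
    by (rule Gamma_plus1)
  then have C: "C = pi powr (n / 2) / Gamma (n / 2)" and C0: "C \<ge> 0"
    using n by (simp_all add: C_def unit_ball_vol_def)
  have "(\<integral>\<^sup>+x. ennreal (rpow ((norm (x::'a))\<^sup>2) s * exp (- (norm x)\<^sup>2)) \<partial>lborel) =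
    (\<integral>\<^sup>+t. ennreal (rpow t s * exp (- t)) \<partial>distr lborel borel (\<lambda>x::'a. (norm x)\<^sup>2))"
    by (subst nn_integral_distr) auto
  also have "\<dots> = (\<integral>\<^sup>+t. ennreal (indicator {0..} t * (C * t powr (n / 2 - 1))) * ennreal (rpow t s * exp (- t)) \<partial>lborel)"
    unfolding distr_norm_power2 C_def n_def by (subst nn_integral_density) auto
  also have "\<dots> = (\<integral>\<^sup>+t. ennreal C * ennreal (indicator {0..} t * t powr (s + n / 2 - 1) / exp t) \<partial>lborel)"
  proof (rule nn_integral_cong_AE, rule eventually_mono[OF AE_lborel_singleton[of 0]])
    fix t :: real assume "t \<noteq> 0"
    then show "ennreal (indicator {0..} t * (C * t powr (n / 2 - 1))) * ennreal (rpow t s * exp (- t)) =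
        ennreal C * ennreal (indicator {0..} t * t powr (s + n / 2 - 1) / exp t)"
      using C0 by (auto simp: indicator_def ennreal_mult'[symmetric] rpow_def exp_minus field_simps
         powr_add[symmetric])
  qed
  also have "\<dots> = ennreal C * ennreal (Gamma (s + n / 2))"
    using s n by (subst nn_integral_cmult) (auto simp: Gamma_conv_nn_integral_real)
  also have "\<dots> = ennreal (pi powr (n / 2) * Gamma (s + n / 2) / Gamma (n / 2))"
    using C0 C by (simp add: ennreal_mult'[symmetric])
  finally show ?thesis .
qed

section \<open>The Haar measure of the rotation group in quaternion coordinates\<close>

lemma borel_measurable_matrixI:
  fixes F :: "'a \<Rightarrow> real^'n^'m"
  assumes "\<And>i j. (\<lambda>x. F x $ i $ j) \<in> borel_measurable M"
  shows "F \<in> borel_measurable M"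
  using assms by (subst borel_measurable_euclidean_space) (auto simp: Basis_vec_def inner_axis)

lemma measurable_vec_nth [measurable]: "(\<lambda>x::real^'n. x $ i) \<in> borel_measurable borel"
  by (intro borel_measurable_continuous_onI continuous_intros)

lemma measurable_matrix_nth [measurable]: "(\<lambda>x::real^'n^'m. x $ i $ j) \<in> borel_measurable borel"
  by (intro borel_measurable_continuous_onI continuous_intros)

lemma measurable_rpow [measurable]: "(\<lambda>t. rpow t s) \<in> borel_measurable borel"
  unfolding rpow_def by measurable

lemma measurable_trace [measurable]: "(\<lambda>A::real^'n^'n. trace A) \<in> borel_measurable borel"
  unfolding trace_def by measurable

lemma measurable_quat_rot [measurable]: "quat_rot \<in> borel_measurable borel"
proof (rule borel_measurable_matrixI)
  have "\<forall>i j. (\<lambda>q. quat_matrix q $ i $ j) \<in> borel_measurable borel"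
    unfolding forall_3 by (simp add: quat_matrix_def Let_def)
  then have [measurable]: "(\<lambda>q. quat_matrix q $ i $ j) \<in> borel_measurable borel" for i j by blast
  show "(\<lambda>q. quat_rot q $ i $ j) \<in> borel_measurable borel" for i j
    unfolding quat_rot_nth by measurable
qed

lemma measurable_matrix_mult [measurable (raw)]:
  fixes F :: "'a \<Rightarrow> real^'n^'m" and G :: "'a \<Rightarrow> real^'k^'n"
  assumes [measurable]: "F \<in> borel_measurable M" "G \<in> borel_measurable M"
  shows "(\<lambda>x. F x ** G x) \<in> borel_measurable M"
  by (rule borel_measurable_matrixI) (simp add: matrix_matrix_mult_def)

lemma quat_mult_orthogonal:
  assumes "norm p = 1"
  shows "orthogonal_transformation (\<lambda>q. quat_mult q p)"
  unfolding orthogonal_transformation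
proof (intro conjI allI linearI)
  show "norm (quat_mult q p) = norm q" for q
    using assms by (simp add: norm_quat_mult)
qed (simp_all add: quat_mult_def vec_eq_iff forall_4 algebra_simps)

text \<open>Right multiplication of the quaternion by a unit quaternion is an isometry of the
four-dimensional space, so it preserves both Lebesgue measure and the radial weight, and it
multiplies the rotation by an arbitrary element of the group.\<close>

lemma nn_integral_quat_rot_right:
  fixes \<phi> :: "real^3^3 \<Rightarrow> ennreal" and w :: "real \<Rightarrow> ennreal"
  assumes [measurable]: "\<phi> \<in> borel_measurable borel" "w \<in> borel_measurable borel"
    and A: "A \<in> SO3"
  shows "(\<integral>\<^sup>+q. \<phi> (quat_rot q ** A) * w (norm q) \<partial>lborel) = (\<integral>\<^sup>+q. \<phi> (quat_rot q) * w (norm q) \<partial>lborel)"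
proof -
  obtain p where p: "norm p = 1" "quat_rot p = A" using quat_rot_surj_unit[OF A] .
  note T = quat_mult_orthogonal[OF p(1)]
  have [measurable]: "(\<lambda>q. quat_mult q p) \<in> borel_measurable borel"
    using orthogonal_transformation_linear[OF T]
    by (intro borel_measurable_continuous_onI linear_continuous_on linear_linear[THEN iffD2])
  have "(\<integral>\<^sup>+q. \<phi> (quat_rot q) * w (norm q) \<partial>lborel)
      = (\<integral>\<^sup>+q. \<phi> (quat_rot q) * w (norm q) \<partial>distr lborel borel (\<lambda>q. quat_mult q p))"
    by (simp only: lborel_distr_orthogonal[OF T])
  also have "\<dots> = (\<integral>\<^sup>+q. \<phi> (quat_rot q ** A) * w (norm q) \<partial>lborel)"
    using p by (subst nn_integral_distr) (auto simp: norm_quat_mult quat_rot_mult)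
  finally show ?thesis by simp
qed

lemma haar_space: "haar_prob_SO3 \<mu> \<Longrightarrow> space \<mu> = SO3"
  unfolding haar_prob_SO3_def by (metis sets_eq_imp_space_eq space_borel space_restrict_space inf_top_right)

text \<open>The measure lives on the subspace \<^const>\<open>SO3\<close> of the space of all matrices. Through this lemma
integrands can be Borel functions of an arbitrary matrix.\<close>

lemma haar_measurable:
  assumes "haar_prob_SO3 \<mu>" "f \<in> measurable borel N"
  shows "f \<in> measurable \<mu> N"
proof -
  have "f \<in> measurable (restrict_space borel SO3) N"
    using assms(2) by (rule measurable_restrict_space1)
  then show ?thesis
    using assms(1) measurable_cong_sets[of \<mu> "restrict_space borel SO3" N N] by (simp add: haar_prob_SO3_def)
qed

lemma haar_measurable_into:
  assumes haar: "haar_prob_SO3 \<mu>" and f: "f \<in> measurable borel borel" and "\<And>A. A \<in> SO3 \<Longrightarrow> f A \<in> SO3"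
  shows "f \<in> measurable \<mu> \<mu>"
proof -
  have "f \<in> measurable \<mu> (restrict_space borel SO3)"
    using assms(3) haar_measurable[OF haar f] haar_space[OF haar]
    by (intro measurable_restrict_space2) auto
  then show ?thesis
    using haar measurable_cong_sets[of \<mu> \<mu> \<mu> "restrict_space borel SO3"] by (simp add: haar_prob_SO3_def)
qed

text \<open>The integration formula that makes the Haar measure explicit. Its proof is that of the uniqueness
of Haar measure: by left invariance the integral of \<open>\<phi>\<close> equals the one of \<open>A \<mapsto> \<phi> (R(q) A)\<close> for
each \<open>q \<noteq> 0\<close>; averaging over \<open>q\<close> and exchanging the integrals leaves an inner integral over \<open>q\<close>
that does not depend on \<open>A\<close>, by right invariance of the Lebesgue side.

The freedom in the radial weight \<open>w\<close> is essential for the applications. A homogeneous function of the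
quaternion occurs in \<open>\<phi> (R(q))\<close> divided by a power of the norm, and \<open>w\<close> is chosen to cancel
exactly this power, up to a Gaussian factor.\<close>

lemma haar_quat_integral:
  fixes \<phi> :: "real^3^3 \<Rightarrow> ennreal" and w :: "real \<Rightarrow> ennreal"
  assumes haar: "haar_prob_SO3 \<mu>"
    and [measurable]: "\<phi> \<in> borel_measurable borel" "w \<in> borel_measurable borel"
  shows "(\<integral>\<^sup>+A. \<phi> A \<partial>\<mu>) * (\<integral>\<^sup>+q. w (norm (q::real^4)) \<partial>lborel)
    = (\<integral>\<^sup>+q. \<phi> (quat_rot q) * w (norm q) \<partial>lborel)"
proof -
  interpret prob_space \<mu> using haar by (simp add: haar_prob_SO3_def)
  interpret pair_sigma_finite "lborel :: (real^4) measure" \<mu> by standard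
  have id [measurable]: "(\<lambda>A. A) \<in> borel_measurable \<mu>" by (rule haar_measurable[OF haar]) simp
  have phi_mu: "\<phi> \<in> borel_measurable \<mu>" by (rule haar_measurable[OF haar]) simp
  have left: "(\<integral>\<^sup>+A. \<phi> A \<partial>\<mu>) = (\<integral>\<^sup>+A. \<phi> (B ** A) \<partial>\<mu>)" if "B \<in> SO3" for B
  proof -
    have "(\<lambda>A. B ** A) \<in> measurable \<mu> \<mu>"
      using that by (intro haar_measurable_into[OF haar]) (auto intro: SO3_mult)
    then have "(\<integral>\<^sup>+A. \<phi> A \<partial>distr \<mu> \<mu> (\<lambda>A. B ** A)) = (\<integral>\<^sup>+A. \<phi> (B ** A) \<partial>\<mu>)"
      using phi_mu by (intro nn_integral_distr) auto
    then show ?thesis using haar that by (simp add: haar_prob_SO3_def)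
  qed
  have snd [measurable]: "snd \<in> borel_measurable (lborel \<Otimes>\<^sub>M \<mu>)"
    using measurable_compose[OF measurable_snd id] by simp
  have "(\<integral>\<^sup>+A. \<phi> A \<partial>\<mu>) * (\<integral>\<^sup>+q. w (norm (q::real^4)) \<partial>lborel)
      = (\<integral>\<^sup>+q. (\<integral>\<^sup>+A. \<phi> A \<partial>\<mu>) * w (norm (q::real^4)) \<partial>lborel)"
    by (intro nn_integral_cmult[symmetric]) auto
  also have "\<dots> = (\<integral>\<^sup>+q. (\<integral>\<^sup>+A. \<phi> (quat_rot q ** A) * w (norm q) \<partial>\<mu>) \<partial>lborel)"
  proof (rule nn_integral_cong_AE, rule eventually_mono[OF AE_lborel_singleton[of 0]])
    fix q :: "real^4" assume "q \<noteq> 0"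
    then have "(\<integral>\<^sup>+A. \<phi> A \<partial>\<mu>) = (\<integral>\<^sup>+A. \<phi> (quat_rot q ** A) \<partial>\<mu>)"
      by (intro left quat_rot_in_SO3)
    then show "(\<integral>\<^sup>+A. \<phi> A \<partial>\<mu>) * w (norm q) = (\<integral>\<^sup>+A. \<phi> (quat_rot q ** A) * w (norm q) \<partial>\<mu>)"
      by (simp add: nn_integral_multc)
  qed
  also have "\<dots> = (\<integral>\<^sup>+A. (\<integral>\<^sup>+q. \<phi> (quat_rot q ** A) * w (norm q) \<partial>lborel) \<partial>\<mu>)"
    by (intro Fubini'[symmetric]) measurable
  also have "\<dots> = (\<integral>\<^sup>+A. (\<integral>\<^sup>+q. \<phi> (quat_rot q) * w (norm q) \<partial>lborel) \<partial>\<mu>)"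
    by (intro nn_integral_cong nn_integral_quat_rot_right) (auto simp: haar_space[OF haar])
  also have "\<dots> = (\<integral>\<^sup>+q. \<phi> (quat_rot q) * w (norm q) \<partial>lborel)"
    by (simp add: emeasure_space_1)
  finally show ?thesis .
qed

lemma gaussian_moment_quat:
  assumes "s \<ge> 0"
  shows "(\<integral>\<^sup>+q. ennreal (rpow ((norm (q::real^4))\<^sup>2) s * exp (- (norm q)\<^sup>2)) \<partial>lborel) = ennreal (pi\<^sup>2 * Gamma (s + 2))"
  using gaussian_moment[where 'a="real^4", OF assms]
  by (simp add: Gamma_numeral)

text \<open>Both sides have the same integral formula over quaternions, by the right invariance of the latter.\<close>

lemma haar_right_invariant:
  assumes haar: "haar_prob_SO3 \<mu>" and M: "M \<in> SO3"
  shows "distr \<mu> \<mu> (\<lambda>A. A ** M) = \<mu>"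
proof (rule measure_eqI)
  have mult: "(\<lambda>A. A ** M) \<in> measurable \<mu> \<mu>"
    using M by (intro haar_measurable_into[OF haar]) (auto intro: SO3_mult)
  have inv: "(\<integral>\<^sup>+A. \<phi> (A ** M) \<partial>\<mu>) = (\<integral>\<^sup>+A. \<phi> A \<partial>\<mu>)"
    if [measurable]: "\<phi> \<in> borel_measurable borel" for \<phi>
  proof -
    define w where "w r = ennreal (exp (- r\<^sup>2))" for r
    have [measurable]: "w \<in> borel_measurable borel" unfolding w_def by measurable
    define Z where "Z = (\<integral>\<^sup>+q. w (norm (q::real^4)) \<partial>lborel)"
    have "Z = ennreal (pi\<^sup>2)"
      using gaussian_moment_quat[of 0] by (simp add: Gamma_numeral Z_def w_def rpow_def)
    then have Z: "Z \<noteq> 0" "Z \<noteq> \<infinity>" by auto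
    have "(\<integral>\<^sup>+A. \<phi> (A ** M) \<partial>\<mu>) * Z = (\<integral>\<^sup>+A. \<phi> A \<partial>\<mu>) * Z"
      unfolding Z_def using haar_quat_integral[OF haar, of "\<lambda>A. \<phi> (A ** M)" w]
        haar_quat_integral[OF haar, of \<phi> w] nn_integral_quat_rot_right[of \<phi> w M] M by simp
    then show ?thesis using Z by (metis ennreal_mult_cancel_left mult.commute infinity_ennreal_def)
  qed
  fix X assume "X \<in> sets (distr \<mu> \<mu> (\<lambda>A. A ** M))"
  then have "X \<in> sets \<mu>" by simp
  then obtain Y where Y: "Y \<in> sets borel" "X = SO3 \<inter> Y"
    using haar unfolding haar_prob_SO3_def sets_restrict_space by auto
  have "emeasure (distr \<mu> \<mu> (\<lambda>A. A ** M)) X = (\<integral>\<^sup>+A. indicator X A \<partial>distr \<mu> \<mu> (\<lambda>A. A ** M))"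
    using \<open>X \<in> sets \<mu>\<close> by simp
  also have "\<dots> = (\<integral>\<^sup>+A. indicator X (A ** M) \<partial>\<mu>)"
    using mult \<open>X \<in> sets \<mu>\<close> by (intro nn_integral_distr) auto
  also have "\<dots> = (\<integral>\<^sup>+A. indicator Y (A ** M) \<partial>\<mu>)"
    using M SO3_mult by (intro nn_integral_cong) (auto simp: haar_space[OF haar] Y(2) indicator_def)
  also have "\<dots> = (\<integral>\<^sup>+A. indicator Y A \<partial>\<mu>)"
    using Y(1) by (intro inv) simp
  also have "\<dots> = (\<integral>\<^sup>+A. indicator X A \<partial>\<mu>)"
    by (intro nn_integral_cong) (auto simp: haar_space[OF haar] Y(2) indicator_def)
  also have "\<dots> = emeasure \<mu> X" using \<open>X \<in> sets \<mu>\<close> by simp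
  finally show "emeasure (distr \<mu> \<mu> (\<lambda>A. A ** M)) X = emeasure \<mu> X" .
qed simp

section \<open>Gaussian moments of monomials\<close>

lemma ennreal_mult_right_cancel_pos:
  assumes "a * ennreal c = b * ennreal c" "c > 0"
  shows "a = b"
proof -
  have "ennreal c * a = ennreal c * b" using assms(1) by (simp add: mult.commute)
  moreover have "ennreal c \<noteq> 0" using assms(2) by simp
  ultimately show ?thesis by (simp only: ennreal_mult_cancel_left ennreal_neq_top simp_thms)
qed

lemma prod_4: "prod f (UNIV::4 set) = f 1 * f 2 * f 3 * f 4"
  unfolding UNIV_4 by (simp add: ac_simps)

lemma nn_integral_prod_vec:
  fixes g :: "'n::finite \<Rightarrow> real \<Rightarrow> ennreal"
  assumes [measurable]: "\<And>i. g i \<in> borel_measurable borel"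
  shows "(\<integral>\<^sup>+q. (\<Prod>i\<in>UNIV. g i ((q::real^'n) $ i)) \<partial>lborel) = (\<Prod>i\<in>UNIV. \<integral>\<^sup>+x. g i x \<partial>lborel)"
proof -
  define ix :: "real^'n \<Rightarrow> 'n" where "ix b = (THE i. b = axis i 1)" for b
  have ix: "ix (axis i 1) = i" for i
    by (simp add: ix_def axis_eq_axis)
  have B: "Basis = range (\<lambda>i::'n. axis i (1::real))" by (auto simp: Basis_vec_def)
  have inj: "inj (\<lambda>i::'n. axis i (1::real))" by (simp add: inj_on_def axis_eq_axis)
  have "(\<integral>\<^sup>+q. (\<Prod>b\<in>Basis. g (ix b) ((q::real^'n) \<bullet> b)) \<partial>lborel) = (\<Prod>b\<in>Basis. \<integral>\<^sup>+x. g (ix b) x \<partial>lborel)"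
    by (intro nn_integral_lborel_prod) auto
  then show ?thesis
    unfolding B prod.reindex[OF inj] by (simp add: ix inner_axis)
qed

text \<open>The exponents refer to the squares of the coordinates, and \<open>rpow\<close> makes the exponent \<open>0\<close> harmless.\<close>

definition quat_monomial :: "real^4 \<Rightarrow> real^4 \<Rightarrow> real" where
  "quat_monomial s q = (\<Prod>i\<in>UNIV. rpow ((q$i)\<^sup>2) (s$i))"

lemma rpow_nonneg: "rpow x s \<ge> 0"
  by (simp add: rpow_def)

lemma quat_monomial_nonneg: "quat_monomial s q \<ge> 0"
  unfolding quat_monomial_def by (intro prod_nonneg) (simp add: rpow_nonneg)

lemma measurable_quat_monomial [measurable]: "quat_monomial s \<in> borel_measurable borel"
  unfolding quat_monomial_def by measurable

lemma gaussian_moment_monomial: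
  assumes s: "\<And>i. s $ i \<ge> 0"
  shows "(\<integral>\<^sup>+q. ennreal (quat_monomial s q * exp (- (norm q)\<^sup>2)) \<partial>lborel)
    = ennreal (\<Prod>i\<in>UNIV. Gamma (s$i + 1/2))"
proof -
  have "(\<integral>\<^sup>+q. ennreal (quat_monomial s q * exp (- (norm q)\<^sup>2)) \<partial>lborel)
      = (\<integral>\<^sup>+q. (\<Prod>i\<in>UNIV. ennreal (rpow ((q$i)\<^sup>2) (s$i) * exp (- (q$i)\<^sup>2))) \<partial>lborel)"
  proof (intro nn_integral_cong)
    fix q :: "real^4"
    have "exp (- (norm q)\<^sup>2) = (\<Prod>i\<in>UNIV. exp (- (q$i)\<^sup>2))"
      unfolding exp_sum[OF finite, symmetric] norm_quat by (simp add: sum_4)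
    then show "ennreal (quat_monomial s q * exp (- (norm q)\<^sup>2))
        = (\<Prod>i\<in>UNIV. ennreal (rpow ((q$i)\<^sup>2) (s$i) * exp (- (q$i)\<^sup>2)))"
      by (simp add: prod_ennreal rpow_nonneg quat_monomial_def prod.distrib)
  qed
  also have "\<dots> = (\<Prod>i\<in>UNIV. \<integral>\<^sup>+x. ennreal (rpow (x\<^sup>2) (s$i) * exp (- x\<^sup>2)) \<partial>lborel)"
    by (intro nn_integral_prod_vec) measurable
  also have "\<dots> = (\<Prod>i\<in>UNIV. ennreal (Gamma (s$i + 1/2)))"
  proof (intro prod.cong refl)
    fix i :: 4
    have "(\<integral>\<^sup>+x. ennreal (rpow (x\<^sup>2) (s$i) * exp (- x\<^sup>2)) \<partial>lborel)
        = ennreal (pi powr (1/2) * Gamma (s$i + 1/2) / Gamma (1/2))"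
      using gaussian_moment[where 'a=real, OF s[of i]] by simp
    then show "(\<integral>\<^sup>+x. ennreal (rpow (x\<^sup>2) (s$i) * exp (- x\<^sup>2)) \<partial>lborel) = ennreal (Gamma (s$i + 1/2))"
      by (simp add: powr_half_sqrt Gamma_one_half_real)
  qed
  also have "\<dots> = ennreal (\<Prod>i\<in>UNIV. Gamma (s$i + 1/2))"
  proof (intro prod_ennreal less_imp_le Gamma_real_pos)
    show "0 < s $ i + 1/2" for i using s[of i] by linarith
  qed
  finally show ?thesis .
qed

section \<open>Integrals of the Cayley density\<close>

lemma measurable_cayley_density [measurable]: "cayley_density \<kappa> \<in> borel_measurable borel"
  unfolding cayley_density_def by measurable

context
  fixes \<kappa> :: real
  assumes kappa: "\<kappa> \<ge> 0"
begin

lemma cayley_density_nonneg: "cayley_density \<kappa> A \<ge> 0"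
  using kappa unfolding cayley_density_def
  by (intro mult_nonneg_nonneg divide_nonneg_nonneg) (auto intro!: rpow_nonneg less_imp_le[OF Gamma_real_pos])

text \<open>Up to a constant, the Cayley density is \<open>(w\<^sup>2 / |q|\<^sup>2) powr \<kappa>\<close>.\<close>

lemma cayley_density_quat:
  assumes "q \<noteq> 0"
  shows "cayley_density \<kappa> (quat_rot q) * rpow ((norm q)\<^sup>2) \<kappa>
    = sqrt pi * Gamma (\<kappa> + 2) / Gamma (\<kappa> + 1/2) * rpow ((q$1)\<^sup>2) \<kappa>"
proof -
  have "rpow (1 + trace (quat_rot q)) \<kappa> * rpow ((norm q)\<^sup>2) \<kappa> = 2 powr (2 * \<kappa>) * rpow ((q$1)\<^sup>2) \<kappa>"
  proof (cases "\<kappa> = 0")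
    case False
    have "rpow (1 + trace (quat_rot q)) \<kappa> * rpow ((norm q)\<^sup>2) \<kappa>
        = ((1 + trace (quat_rot q)) * (norm q)\<^sup>2) powr \<kappa>"
      using False assms powr_mult[of "1 + trace (quat_rot q)" "(norm q)\<^sup>2" \<kappa>]
      by (simp add: rpow_def)
    also have "(1 + trace (quat_rot q)) * (norm q)\<^sup>2 = 4 * (q$1)\<^sup>2"
      using assms by (simp add: trace_quat_rot)
    also have "(4 * (q$1)\<^sup>2) powr \<kappa> = 4 powr \<kappa> * ((q$1)\<^sup>2) powr \<kappa>"
      by (simp add: powr_mult)
    also have "(4::real) powr \<kappa> = 2 powr (2 * \<kappa>)"
      using powr_powr[of 2 2 \<kappa>] by simp
    finally show ?thesis using False by (simp add: rpow_def)
  qed (simp add: rpow_def)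
  then show ?thesis
    by (simp add: cayley_density_def mult.assoc)
qed

text \<open>With the radial weight \<open>|q| powr (2 \<kappa>)\<close> times a Gaussian, the integral becomes the Gaussian moment of
the single coordinate \<open>w\<close>, divided by the corresponding moment of the norm.\<close>

lemma nn_integral_cayley_density:
  assumes haar: "haar_prob_SO3 \<mu>"
  shows "(\<integral>\<^sup>+A. ennreal (cayley_density \<kappa> A) \<partial>\<mu>) = 1"
proof -
  define s :: "real^4" where "s = vector [\<kappa>, 0, 0, 0]"
  define G where "G = sqrt pi * Gamma (\<kappa> + 2) / Gamma (\<kappa> + 1/2)"
  define Z where "Z = pi\<^sup>2 * Gamma (\<kappa> + 2)"
  have pos: "Gamma (\<kappa> + 2) > 0" "Gamma (\<kappa> + 1/2) > 0" using kappa by (auto intro!: Gamma_real_pos)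
  have s: "s $ i \<ge> 0" for i using kappa exhaust_4[of i] by (auto simp: s_def)
  have "(\<integral>\<^sup>+A. ennreal (cayley_density \<kappa> A) \<partial>\<mu>) * ennreal Z
      = (\<integral>\<^sup>+q. ennreal (cayley_density \<kappa> (quat_rot q)) * ennreal (rpow ((norm q)\<^sup>2) \<kappa> * exp (- (norm q)\<^sup>2)) \<partial>lborel)"
  proof -
    have m1: "(\<lambda>A. ennreal (cayley_density \<kappa> A)) \<in> borel_measurable borel" by simp
    have m2: "(\<lambda>r. ennreal (rpow (r\<^sup>2) \<kappa> * exp (- r\<^sup>2))) \<in> borel_measurable borel" by simp
    have "ennreal Z = (\<integral>\<^sup>+q. ennreal (rpow ((norm (q::real^4))\<^sup>2) \<kappa> * exp (- (norm q)\<^sup>2)) \<partial>lborel)"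
      using gaussian_moment_quat[OF kappa] by (simp add: Z_def)
    then show ?thesis
      using haar_quat_integral[OF haar m1 m2] by (simp only:)
  qed
  also have "\<dots> = (\<integral>\<^sup>+q. ennreal G * ennreal (quat_monomial s q * exp (- (norm q)\<^sup>2)) \<partial>lborel)"
  proof (rule nn_integral_cong_AE, rule eventually_mono[OF AE_lborel_singleton[of 0]])
    fix q :: "real^4" assume "q \<noteq> 0"
    have "quat_monomial s q = rpow ((q$1)\<^sup>2) \<kappa>"
      by (simp add: quat_monomial_def prod_4 s_def rpow_def)
    then show "ennreal (cayley_density \<kappa> (quat_rot q)) * ennreal (rpow ((norm q)\<^sup>2) \<kappa> * exp (- (norm q)\<^sup>2))
        = ennreal G * ennreal (quat_monomial s q * exp (- (norm q)\<^sup>2))"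
      using cayley_density_quat[OF \<open>q \<noteq> 0\<close>] cayley_density_nonneg pos
      by (simp add: ennreal_mult[symmetric] rpow_nonneg G_def mult.assoc[symmetric])
  qed
  also have "\<dots> = ennreal G * ennreal (\<Prod>i\<in>UNIV. Gamma (s$i + 1/2))"
    unfolding gaussian_moment_monomial[OF s, symmetric]
    by (intro nn_integral_cmult) simp
  also have "\<dots> = ennreal (G * (Gamma (\<kappa> + 1/2) * sqrt pi ^ 3))"
    using pos by (subst ennreal_mult[symmetric])
      (auto simp: prod_4 s_def Gamma_one_half_real power3_eq_cube G_def)
  also have "G * (Gamma (\<kappa> + 1/2) * sqrt pi ^ 3) = Z"
    using pos by (simp add: G_def Z_def power3_eq_cube power2_eq_square)
  finally have "(\<integral>\<^sup>+A. ennreal (cayley_density \<kappa> A) \<partial>\<mu>) * ennreal Z = 1 * ennreal Z" by simp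
  moreover have "Z > 0" using pos by (simp add: Z_def)
  ultimately show ?thesis by (rule ennreal_mult_right_cancel_pos)
qed

text \<open>The sum of two squared entries is integrated because it is a combination of monomials with
nonnegative coefficients. Now the radial weight is \<open>|q| powr (2 \<kappa> + 4)\<close>, as the squared entries have
\<open>|q|\<^sup>4\<close> in the denominator. The set \<open>S\<close> lists the exponents of the four monomials of
\<open>(w\<^sup>2) powr \<kappa> (w\<^sup>2 + z\<^sup>2) (x\<^sup>2 + y\<^sup>2)\<close>.\<close>

lemma nn_integral_cayley_third_row:
  assumes haar: "haar_prob_SO3 \<mu>"
  shows "(\<integral>\<^sup>+A. ennreal (cayley_density \<kappa> A * ((A$3$1)\<^sup>2 + (A$3$2)\<^sup>2)) \<partial>\<mu>) = ennreal (4 * (\<kappa> + 1) / ((\<kappa> + 2) * (\<kappa> + 3)))"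
proof -
  define G where "G = sqrt pi * Gamma (\<kappa> + 2) / Gamma (\<kappa> + 1/2)"
  define Z where "Z = pi\<^sup>2 * Gamma (\<kappa> + 4)"
  define S :: "(real^4) set" where "S = {vector [\<kappa> + 1, 1, 0, 0], vector [\<kappa> + 1, 0, 1, 0], vector [\<kappa>, 1, 0, 1], vector [\<kappa>, 0, 1, 1]}"
  have sumS: "(\<Sum>s\<in>S. f s) = f (vector [\<kappa> + 1, 1, 0, 0]) + f (vector [\<kappa> + 1, 0, 1, 0])
      + f (vector [\<kappa>, 1, 0, 1]) + f (vector [\<kappa>, 0, 1, 1])" for f :: "_ \<Rightarrow> 'z::comm_monoid_add"
    unfolding S_def by (simp add: vec_eq_iff forall_4 add.assoc)
  have pos: "Gamma (\<kappa> + 2) > 0" "Gamma (\<kappa> + 1/2) > 0" using kappa by (auto intro!: Gamma_real_pos)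
  have s: "s $ i \<ge> 0" if "s \<in> S" for s i using that kappa exhaust_4[of i] by (auto simp: S_def)
  have G0: "4 * G \<ge> 0" using pos by (simp add: G_def)
  have prods: "0 \<le> (\<Prod>i\<in>UNIV. Gamma (s$i + 1/2))" if "s \<in> S" for s
  proof (intro prod_nonneg less_imp_le Gamma_real_pos)
    show "0 < s $ i + 1/2" for i using s[OF that, of i] by linarith
  qed
  have "(\<integral>\<^sup>+A. ennreal (cayley_density \<kappa> A * ((A$3$1)\<^sup>2 + (A$3$2)\<^sup>2)) \<partial>\<mu>) * ennreal Z
      = (\<integral>\<^sup>+q. ennreal (cayley_density \<kappa> (quat_rot q) * ((quat_rot q$3$1)\<^sup>2 + (quat_rot q$3$2)\<^sup>2))
          * ennreal (rpow ((norm q)\<^sup>2) (\<kappa> + 2) * exp (- (norm q)\<^sup>2)) \<partial>lborel)"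
  proof -
    have m1: "(\<lambda>A. ennreal (cayley_density \<kappa> A * ((A$3$1)\<^sup>2 + (A$3$2)\<^sup>2))) \<in> borel_measurable borel" by simp
    have m2: "(\<lambda>r. ennreal (rpow (r\<^sup>2) (\<kappa> + 2) * exp (- r\<^sup>2))) \<in> borel_measurable borel" by simp
    have "ennreal Z = (\<integral>\<^sup>+q. ennreal (rpow ((norm (q::real^4))\<^sup>2) (\<kappa> + 2) * exp (- (norm q)\<^sup>2)) \<partial>lborel)"
      using gaussian_moment_quat[of "\<kappa> + 2"] kappa by (simp add: Z_def add.assoc)
    then show ?thesis
      using haar_quat_integral[OF haar m1 m2] by (simp only:)
  qed
  also have "\<dots> = (\<integral>\<^sup>+q. ennreal (4 * G) * (\<Sum>s\<in>S. ennreal (quat_monomial s q * exp (- (norm q)\<^sup>2))) \<partial>lborel)"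
  proof (rule nn_integral_cong_AE, rule eventually_mono[OF AE_lborel_singleton[of 0]])
    fix q :: "real^4" assume "q \<noteq> 0"
    have r0: "rpow x 0 = 1" "rpow (x\<^sup>2) 1 = x\<^sup>2" for x :: real
      by (auto simp: rpow_def)
    have r1: "rpow (x\<^sup>2) (\<kappa> + 1) = rpow (x\<^sup>2) \<kappa> * x\<^sup>2" for x :: real
      using kappa by (auto simp: rpow_def powr_add)
    have r2: "rpow ((norm q)\<^sup>2) (\<kappa> + 2) = rpow ((norm q)\<^sup>2) \<kappa> * ((norm q)\<^sup>2)\<^sup>2"
      using kappa \<open>q \<noteq> 0\<close> by (auto simp: rpow_def powr_add powr_numeral)
    have mono: "(\<Sum>s\<in>S. quat_monomial s q) = rpow ((q$1)\<^sup>2) \<kappa> * (((q$1)\<^sup>2 + (q$4)\<^sup>2) * ((q$2)\<^sup>2 + (q$3)\<^sup>2))"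
      by (simp add: sumS quat_monomial_def prod_4 r0 r1) (simp add: algebra_simps)
    have "cayley_density \<kappa> (quat_rot q) * ((quat_rot q$3$1)\<^sup>2 + (quat_rot q$3$2)\<^sup>2) * rpow ((norm q)\<^sup>2) (\<kappa> + 2)
        = (cayley_density \<kappa> (quat_rot q) * rpow ((norm q)\<^sup>2) \<kappa>)
           * (((quat_rot q$3$1)\<^sup>2 + (quat_rot q$3$2)\<^sup>2) * ((norm q)\<^sup>2)\<^sup>2)"
      by (simp only: r2 mult_ac)
    also have "((quat_rot q$3$1)\<^sup>2 + (quat_rot q$3$2)\<^sup>2) * ((norm q)\<^sup>2)\<^sup>2
        = 4 * (((q$1)\<^sup>2 + (q$4)\<^sup>2) * ((q$2)\<^sup>2 + (q$3)\<^sup>2))"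
      using \<open>q \<noteq> 0\<close> by (simp add: quat_rot_third_row)
    also have "cayley_density \<kappa> (quat_rot q) * rpow ((norm q)\<^sup>2) \<kappa> = G * rpow ((q$1)\<^sup>2) \<kappa>"
      using cayley_density_quat[OF \<open>q \<noteq> 0\<close>] by (simp add: G_def)
    finally have eq: "cayley_density \<kappa> (quat_rot q) * ((quat_rot q$3$1)\<^sup>2 + (quat_rot q$3$2)\<^sup>2) * rpow ((norm q)\<^sup>2) (\<kappa> + 2)
        = 4 * G * (\<Sum>s\<in>S. quat_monomial s q)"
      by (simp only: mono mult_ac)
    have "ennreal (cayley_density \<kappa> (quat_rot q) * ((quat_rot q$3$1)\<^sup>2 + (quat_rot q$3$2)\<^sup>2))
          * ennreal (rpow ((norm q)\<^sup>2) (\<kappa> + 2) * exp (- (norm q)\<^sup>2))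
        = ennreal (cayley_density \<kappa> (quat_rot q) * ((quat_rot q$3$1)\<^sup>2 + (quat_rot q$3$2)\<^sup>2)
            * rpow ((norm q)\<^sup>2) (\<kappa> + 2) * exp (- (norm q)\<^sup>2))"
      using cayley_density_nonneg by (subst ennreal_mult[symmetric]) (auto simp: rpow_nonneg mult.assoc)
    also have "\<dots> = ennreal (4 * G * (\<Sum>s\<in>S. quat_monomial s q * exp (- (norm q)\<^sup>2)))"
      unfolding eq by (simp add: sum_distrib_right mult.assoc)
    also have "\<dots> = ennreal (4 * G) * (\<Sum>s\<in>S. ennreal (quat_monomial s q * exp (- (norm q)\<^sup>2)))"
      using G0 by (subst ennreal_mult') (simp_all add: quat_monomial_nonneg)
    finally show "ennreal (cayley_density \<kappa> (quat_rot q) * ((quat_rot q$3$1)\<^sup>2 + (quat_rot q$3$2)\<^sup>2))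
          * ennreal (rpow ((norm q)\<^sup>2) (\<kappa> + 2) * exp (- (norm q)\<^sup>2))
        = ennreal (4 * G) * (\<Sum>s\<in>S. ennreal (quat_monomial s q * exp (- (norm q)\<^sup>2)))" .
  qed
  also have "\<dots> = ennreal (4 * G) * (\<Sum>s\<in>S. \<integral>\<^sup>+q. ennreal (quat_monomial s q * exp (- (norm q)\<^sup>2)) \<partial>lborel)"
    by (simp add: nn_integral_cmult nn_integral_sum)
  also have "\<dots> = ennreal (4 * G * (\<Sum>s\<in>S. \<Prod>i\<in>UNIV. Gamma (s$i + 1/2)))"
    using G0 prods by (subst ennreal_mult') (simp_all add: sum_ennreal gaussian_moment_monomial s)
  also have "4 * G * (\<Sum>s\<in>S. \<Prod>i\<in>UNIV. Gamma (s$i + 1/2)) = 4 * (\<kappa> + 1) / ((\<kappa> + 2) * (\<kappa> + 3)) * Z"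
  proof -
    have ni: "x \<notin> \<int>\<^sub>\<le>\<^sub>0" if "x > 0" for x :: real using that by (auto elim!: nonpos_Ints_cases)
    have g1: "Gamma (\<kappa> + 3/2) = (\<kappa> + 1/2) * Gamma (\<kappa> + 1/2)"
      using Gamma_plus1[of "\<kappa> + 1/2"] ni[of "\<kappa> + 1/2"] kappa by (simp add: add.assoc)
    have g2: "Gamma (3/2 :: real) = sqrt pi / 2"
      using Gamma_plus1[of "1/2 :: real"] ni[of "1/2"] by (simp add: Gamma_one_half_real)
    have g3: "Gamma (\<kappa> + 4) = (\<kappa> + 3) * ((\<kappa> + 2) * Gamma (\<kappa> + 2))"
      using Gamma_plus1[of "\<kappa> + 3"] Gamma_plus1[of "\<kappa> + 2"] ni[of "\<kappa> + 3"] ni[of "\<kappa> + 2"] kappa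
      by (simp add: add.assoc)
    have "(\<Sum>s\<in>S. \<Prod>i\<in>UNIV. Gamma (s$i + 1/2)) = 2 * (\<kappa> + 1/2) * Gamma (\<kappa> + 1/2) * (sqrt pi / 2) * sqrt pi * sqrt pi
        + 2 * Gamma (\<kappa> + 1/2) * (sqrt pi / 2) * (sqrt pi / 2) * sqrt pi"
      by (simp add: sumS prod_4 Gamma_one_half_real g1 g2 add.assoc) (simp add: field_simps)
    also have "\<dots> = (\<kappa> + 1) * Gamma (\<kappa> + 1/2) * (pi * sqrt pi)"
    proof -
      have pi: "sqrt pi * (sqrt pi * x) = pi * x" for x by (simp add: mult.assoc[symmetric])
      show ?thesis by (simp add: algebra_simps pi)
    qed
    finally have "4 * G * (\<Sum>s\<in>S. \<Prod>i\<in>UNIV. Gamma (s$i + 1/2))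
        = 4 * (\<kappa> + 1) * (pi * sqrt pi) * (G * Gamma (\<kappa> + 1/2))"
      by (simp only: mult_ac)
    also have "G * Gamma (\<kappa> + 1/2) = sqrt pi * Gamma (\<kappa> + 2)"
      using pos by (simp add: G_def)
    also have "4 * (\<kappa> + 1) * (pi * sqrt pi) * (sqrt pi * Gamma (\<kappa> + 2))
        = 4 * (\<kappa> + 1) * pi\<^sup>2 * Gamma (\<kappa> + 2)"
      by (simp add: power2_eq_square)
    also have "\<dots> = 4 * (\<kappa> + 1) / ((\<kappa> + 2) * (\<kappa> + 3)) * Z"
      using kappa by (simp add: Z_def g3)
    finally show ?thesis .
  qed
  finally have "(\<integral>\<^sup>+A. ennreal (cayley_density \<kappa> A * ((A$3$1)\<^sup>2 + (A$3$2)\<^sup>2)) \<partial>\<mu>) * ennreal Z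
      = ennreal (4 * (\<kappa> + 1) / ((\<kappa> + 2) * (\<kappa> + 3))) * ennreal Z"
    by (subst ennreal_mult'[symmetric]) (use kappa in simp_all)
  moreover have "Z > 0" using kappa by (auto simp: Z_def intro!: Gamma_real_pos)
  ultimately show ?thesis by (rule ennreal_mult_right_cancel_pos)
qed

end

section \<open>Second moments of the third row\<close>

lemma haar_integral_mult_right:
  fixes g :: "real^3^3 \<Rightarrow> real"
  assumes haar: "haar_prob_SO3 \<mu>" and M: "M \<in> SO3" and [measurable]: "g \<in> borel_measurable borel"
  shows "has_bochner_integral \<mu> (\<lambda>A. g (A ** M)) x \<longleftrightarrow> has_bochner_integral \<mu> g x"
proof -
  have T: "(\<lambda>A. A ** M) \<in> measurable \<mu> \<mu>"
    using M by (intro haar_measurable_into[OF haar]) (auto intro: SO3_mult)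
  have g: "g \<in> borel_measurable \<mu>" by (rule haar_measurable[OF haar]) simp
  have "has_bochner_integral (distr \<mu> \<mu> (\<lambda>A. A ** M)) g x \<longleftrightarrow> has_bochner_integral \<mu> (\<lambda>A. g (A ** M)) x"
    using T g by (simp add: has_bochner_integral_iff integral_distr integrable_distr_eq)
  then show ?thesis by (simp add: haar_right_invariant[OF haar M])
qed

lemma haar_integral_mult_left:
  fixes g :: "real^3^3 \<Rightarrow> real"
  assumes haar: "haar_prob_SO3 \<mu>" and M: "M \<in> SO3" and [measurable]: "g \<in> borel_measurable borel"
  shows "(LINT A|\<mu>. g (M ** A)) = (LINT A|\<mu>. g A)"
proof -
  have T: "(\<lambda>A. M ** A) \<in> measurable \<mu> \<mu>"
    using M by (intro haar_measurable_into[OF haar]) (auto intro: SO3_mult)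
  have g: "g \<in> borel_measurable \<mu>" by (rule haar_measurable[OF haar]) simp
  have "integral\<^sup>L (distr \<mu> \<mu> (\<lambda>A. M ** A)) g = (LINT A|\<mu>. g (M ** A))"
    by (rule integral_distr[OF T g])
  then show ?thesis using haar M by (simp add: haar_prob_SO3_def)
qed

lemma haar_integral_conj:
  fixes g :: "real^3^3 \<Rightarrow> real"
  assumes haar: "haar_prob_SO3 \<mu>" and B: "B \<in> SO3" and [measurable]: "g \<in> borel_measurable borel"
  shows "(LINT A|\<mu>. g (B ** A ** transpose B)) = (LINT A|\<mu>. g A)"
proof -
  have "(LINT A|\<mu>. g (B ** A ** transpose B)) = (LINT A|\<mu>. g (A ** transpose B))"
    by (rule haar_integral_mult_left[OF haar B, of "\<lambda>A. g (A ** transpose B)"]) simp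
  also have "\<dots> = (LINT A|\<mu>. g A)"
    using haar_integral_mult_right[OF haar SO3_transpose[OF B] assms(3)]
    by (metis has_bochner_integral_iff not_integrable_integral_eq)
  finally show ?thesis .
qed

lemma SO3_entry_bound:
  assumes "A \<in> SO3" shows "\<bar>A $ i $ j\<bar> \<le> 1"
proof -
  have "(\<Sum>k\<in>UNIV. A$i$k * A$i$k) = 1" using SO3_equations(2)[OF assms] by simp
  moreover have "A$i$j * A$i$j \<le> (\<Sum>k\<in>UNIV. A$i$k * A$i$k)"
    by (rule member_le_sum) auto
  ultimately show ?thesis by (simp add: abs_square_le_1[symmetric] power2_eq_square)
qed

text \<open>The lower bound is read off from the quaternion coordinates, where \<open>1 + trace A\<close> equals \<open>4 w\<^sup>2 / |q|\<^sup>2\<close>.\<close>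

lemma SO3_trace_bounds:
  assumes "A \<in> SO3" shows "0 \<le> 1 + trace A" "1 + trace A \<le> 4"
proof -
  obtain q where "q \<noteq> 0" "quat_rot q = A" using quat_rot_surj[OF assms] by blast
  then show "0 \<le> 1 + trace A" using trace_quat_rot[of q] by simp
  show "1 + trace A \<le> 4"
    using SO3_entry_bound[OF assms, of 1 1] SO3_entry_bound[OF assms, of 2 2] SO3_entry_bound[OF assms, of 3 3]
    by (simp add: trace_def sum_3)
qed

context
  fixes \<kappa> :: real and \<mu> :: "(real^3^3) measure"
  assumes kappa: "\<kappa> \<ge> 0" and haar: "haar_prob_SO3 \<mu>"
begin

lemma integrable_cayley_times:
  fixes g :: "real^3^3 \<Rightarrow> real"
  assumes [measurable]: "g \<in> borel_measurable borel" and g: "\<And>A. A \<in> SO3 \<Longrightarrow> \<bar>g A\<bar> \<le> 1"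
  shows "integrable \<mu> (\<lambda>A. cayley_density \<kappa> A * g A)"
proof -
  interpret prob_space \<mu> using haar by (simp add: haar_prob_SO3_def)
  define c where "c = sqrt pi * Gamma (\<kappa> + 2) / (2 powr (2 * \<kappa>) * Gamma (\<kappa> + 1/2))"
  have "Gamma (\<kappa> + 2) > 0" "Gamma (\<kappa> + 1/2) > 0" using kappa by (auto intro!: Gamma_real_pos)
  then have c: "c \<ge> 0" by (simp add: c_def)
  show ?thesis
  proof (rule integrable_const_bound)
    show "AE A in \<mu>. norm (cayley_density \<kappa> A * g A) \<le> c * rpow 4 \<kappa> * 1"
    proof (rule AE_I2)
      fix A assume "A \<in> space \<mu>"
      then have A: "A \<in> SO3" by (simp add: haar_space[OF haar])
      have "rpow (1 + trace A) \<kappa> \<le> rpow 4 \<kappa>"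
        using SO3_trace_bounds[OF A] kappa by (auto simp: rpow_def intro: powr_mono2)
      then have "cayley_density \<kappa> A \<le> c * rpow 4 \<kappa>"
        using c by (simp add: cayley_density_def c_def[symmetric] mult_left_mono)
      then have "\<bar>cayley_density \<kappa> A\<bar> * \<bar>g A\<bar> \<le> c * rpow 4 \<kappa> * 1"
        using g[OF A] cayley_density_nonneg[OF kappa, of A] by (intro mult_mono) auto
      then show "norm (cayley_density \<kappa> A * g A) \<le> c * rpow 4 \<kappa> * 1" by (simp add: abs_mult)
    qed
    show "(\<lambda>A. cayley_density \<kappa> A * g A) \<in> borel_measurable \<mu>"
      by (rule haar_measurable[OF haar]) simp
  qed
qed

definition row_moment :: "3 \<Rightarrow> 3 \<Rightarrow> real" where
  "row_moment k l = (LINT A|\<mu>. cayley_density \<kappa> A * (A$3$k * A$3$l))"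

lemma row_moment: "has_bochner_integral \<mu> (\<lambda>A. cayley_density \<kappa> A * (A$3$k * A$3$l)) (row_moment k l)"
  unfolding has_bochner_integral_iff row_moment_def
proof (intro conjI integrable_cayley_times refl)
  show "\<bar>A$3$k * A$3$l\<bar> \<le> 1" if "A \<in> SO3" for A
    using SO3_entry_bound[OF that] by (simp add: abs_mult mult_le_one)
qed simp

lemma cayley_total: "has_bochner_integral \<mu> (cayley_density \<kappa>) 1"
  using nn_integral_cayley_density[OF kappa haar] cayley_density_nonneg[OF kappa]
    haar_measurable[OF haar, of "cayley_density \<kappa>" borel]
  by (intro has_bochner_integral_nn_integral) auto

text \<open>The trace, hence the density, is invariant under conjugation, and the Haar measure is bi-invariant.\<close>

lemma row_moment_conj:
  assumes "B \<in> SO3"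
  shows "row_moment k l = (LINT A|\<mu>. cayley_density \<kappa> A *
    ((B ** A ** transpose B)$3$k * (B ** A ** transpose B)$3$l))"
proof -
  have "trace (B ** A ** transpose B) = trace A" for A
    using SO3_inverse(1)[OF assms] by (metis trace_mul_sym matrix_mul_assoc matrix_mul_lid)
  then have "cayley_density \<kappa> (B ** A ** transpose B) = cayley_density \<kappa> A" for A
    by (simp add: cayley_density_def)
  then show ?thesis
    using haar_integral_conj[OF haar assms, of "\<lambda>A. cayley_density \<kappa> A * (A$3$k * A$3$l)"]
    by (simp add: row_moment_def)
qed

text \<open>Conjugation by the half turn about the axis \<open>k\<close> changes the sign of exactly one of the two entries
in columns \<open>k\<close> and \<open>l\<close> of the third row.\<close>

lemma row_moment_offdiag:
  assumes "k \<noteq> l" shows "row_moment k l = 0"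
proof -
  let ?D = "\<lambda>i::3. diag3 (if i = 1 then 1 else -1) (if i = 2 then 1 else -1) (if i = 3 then 1 else -1)"
  have D: "?D i \<in> SO3" for i
    using exhaust_3[of i]
    by (auto simp: SO3_def rotation_matrix_def orthogonal_matrix_def det_3 vec_eq_iff forall_3
        matrix_matrix_mult_def sum_3 transpose_def mat_def diag3_def)
  have e: "(?D i ** A ** transpose (?D i)) $ 3 $ j = (if (i = 3) = (i = j) then A$3$j else - A$3$j)" for i j A
    using exhaust_3[of i] exhaust_3[of j]
    by (auto simp: matrix_matrix_mult_def sum_3 transpose_def diag3_def)
  have "row_moment k l = - row_moment k l"
    using row_moment_conj[OF D[of k], of k l] assms unfolding e row_moment_def
    by (cases "k = 3") simp_all
  then show ?thesis by simp
qed

text \<open>A quarter turn about the third axis exchanges the first two entries of the third row, up to a sign.\<close>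

lemma row_moment_symmetric: "row_moment 1 1 = row_moment 2 2"
proof -
  define B :: "real^3^3" where "B = vector [vector [0, -1, 0], vector [1, 0, 0], vector [0, 0, 1]]"
  have B: "B \<in> SO3"
    by (auto simp: SO3_def rotation_matrix_def orthogonal_matrix_def det_3 vec_eq_iff forall_3
        matrix_matrix_mult_def sum_3 transpose_def mat_def B_def)
  have "(B ** A ** transpose B) $ 3 $ 1 = - A$3$2" for A
    by (auto simp: matrix_matrix_mult_def sum_3 transpose_def B_def)
  then show ?thesis
    using row_moment_conj[OF B, of 1 1] by (simp add: row_moment_def)
qed

text \<open>The two unknown diagonal moments follow from two linear relations: the value of the integral of
\<open>A\<^sub>3\<^sub>1\<^sup>2 + A\<^sub>3\<^sub>2\<^sup>2\<close> computed with quaternions, and the fact that a row of a rotation is a unit vector.\<close>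

lemma row_moment_eq:
  "row_moment k l = (if k = l then (vector
     [2 * (\<kappa> + 1) / (6 + 5 * \<kappa> + \<kappa>\<^sup>2), 2 * (\<kappa> + 1) / (6 + 5 * \<kappa> + \<kappa>\<^sup>2), (2 + \<kappa> + \<kappa>\<^sup>2) / (6 + 5 * \<kappa> + \<kappa>\<^sup>2)] :: real^3) $ k else 0)"
proof -
  let ?N = "6 + 5 * \<kappa> + \<kappa>\<^sup>2"
  have N: "(\<kappa> + 2) * (\<kappa> + 3) = ?N" by (simp add: power2_eq_square algebra_simps)
  have N0: "?N > 0" using kappa by (simp add: add_pos_nonneg)
  have "has_bochner_integral \<mu> (\<lambda>A. cayley_density \<kappa> A * (A$3$1 * A$3$1) + cayley_density \<kappa> A * (A$3$2 * A$3$2))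
      (row_moment 1 1 + row_moment 2 2)"
    by (intro has_bochner_integral_add row_moment)
  moreover have "has_bochner_integral \<mu> (\<lambda>A. cayley_density \<kappa> A * ((A$3$1)\<^sup>2 + (A$3$2)\<^sup>2)) (4 * (\<kappa> + 1) / ?N)"
  proof (rule has_bochner_integral_nn_integral)
    show "(\<lambda>A. cayley_density \<kappa> A * ((A$3$1)\<^sup>2 + (A$3$2)\<^sup>2)) \<in> borel_measurable \<mu>"
      by (rule haar_measurable[OF haar]) simp
  qed (use nn_integral_cayley_third_row[OF kappa haar] cayley_density_nonneg[OF kappa] kappa N0 N in auto)
  ultimately have 12: "row_moment 1 1 + row_moment 2 2 = 4 * (\<kappa> + 1) / ?N"
    using has_bochner_integral_eq by (fastforce simp: distrib_left power2_eq_square)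
  have "has_bochner_integral \<mu> (\<lambda>A. cayley_density \<kappa> A * (A$3$1 * A$3$1) + cayley_density \<kappa> A * (A$3$2 * A$3$2)
        + cayley_density \<kappa> A * (A$3$3 * A$3$3)) (row_moment 1 1 + row_moment 2 2 + row_moment 3 3)"
    by (intro has_bochner_integral_add row_moment)
  moreover have "cayley_density \<kappa> A * (A$3$1 * A$3$1) + cayley_density \<kappa> A * (A$3$2 * A$3$2)
        + cayley_density \<kappa> A * (A$3$3 * A$3$3) = cayley_density \<kappa> A" if "A \<in> space \<mu>" for A
  proof -
    have "A$3$1 * A$3$1 + A$3$2 * A$3$2 + A$3$3 * A$3$3 = 1"
      using SO3_equations(2)[of A] that by (simp add: haar_space[OF haar] sum_3)
    then show ?thesis by (simp add: distrib_left[symmetric])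
  qed
  ultimately have "has_bochner_integral \<mu> (cayley_density \<kappa>) (row_moment 1 1 + row_moment 2 2 + row_moment 3 3)"
    by (simp cong: has_bochner_integral_cong)
  then have 123: "row_moment 1 1 + row_moment 2 2 + row_moment 3 3 = 1"
    using cayley_total by (rule has_bochner_integral_eq)
  have "4 * (\<kappa> + 1) / ?N = 4 * ((\<kappa> + 1) / ?N)" "2 * (\<kappa> + 1) / ?N = 2 * ((\<kappa> + 1) / ?N)"
    by (simp_all only: times_divide_eq_right)
  then have "row_moment 1 1 = 2 * (\<kappa> + 1) / ?N" "row_moment 2 2 = 2 * (\<kappa> + 1) / ?N"
    using 12 row_moment_symmetric by linarith+
  moreover have "row_moment 3 3 = (2 + \<kappa> + \<kappa>\<^sup>2) / ?N"
  proof -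
    have "row_moment 3 3 = 1 - 4 * (\<kappa> + 1) / ?N" using 12 123 by linarith
    also have "\<dots> = (2 + \<kappa> + \<kappa>\<^sup>2) / ?N" using N0 by (simp add: field_simps)
    finally show ?thesis .
  qed
  ultimately show ?thesis
    using exhaust_3[of k] row_moment_offdiag[of k l] by auto
qed

end

section \<open>Gram matrices\<close>

lemma Gram_mult_SO3:
  fixes V :: "real^'l^3"
  assumes "A \<in> SO3" shows "Gram (A ** V) = Gram V"
proof -
  have "Gram (A ** V) = transpose V ** (transpose A ** A) ** V"
    by (simp add: Gram_def matrix_transpose_mul matrix_mul_assoc)
  then show ?thesis by (simp add: SO3_inverse[OF assms] Gram_def)
qed

lemma Gram_nth: "Gram (W :: real^'l^3) $ i $ j = W$1$i * W$1$j + W$2$i * W$2$j + W$3$i * W$3$j"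
  by (simp add: Gram_def matrix_matrix_mult_def transpose_def sum_3)

lemma Gram_projection:
  "Gram (diag3 1 1 0 ** (W :: real^'l^3)) $ i $ j = Gram W $ i $ j - W$3$i * W$3$j"
  by (simp add: Gram_nth) (simp add: diag3_def matrix_matrix_mult_def sum_3)

text \<open>Substituting \<open>A = R M\<close> moves \<open>M\<close> into \<open>U = M V\<close>. The projection removes the third row of
\<open>R U\<close> from the Gram matrix, and that row is a linear combination of the rows of \<open>U\<close> with
coefficients \<open>R\<^sub>3\<^sub>k\<close>; so only the second moments of the third row of \<open>R\<close> are integrated.\<close>

lemma has_bochner_integral_cayley_Gram:
  fixes V :: "real^'l^3"
  assumes haar: "haar_prob_SO3 \<mu>" and M: "M \<in> SO3" and kappa: "\<kappa> \<ge> 0"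
  shows "has_bochner_integral \<mu>
     (\<lambda>A. (cayley_density \<kappa> (A ** transpose M) *\<^sub>R Gram (diag3 1 1 0 ** A ** V)) $ i $ j)
     ((Gram V - Gram (D_cayley \<kappa> ** M ** V)) $ i $ j)"
    (is "has_bochner_integral \<mu> ?F ?I")
proof -
  let ?N = "6 + 5 * \<kappa> + \<kappa>\<^sup>2"
  define U where "U = M ** V"
  define S where "S = row_moment \<kappa> \<mu>"
  have F_measurable: "?F \<in> borel_measurable borel"
    by (simp only: vector_scaleR_component real_scaleR_def Gram_nth) measurable
  have F: "?F (R ** M) = Gram V $ i $ j * cayley_density \<kappa> R
      - (\<Sum>k\<in>UNIV. \<Sum>l\<in>UNIV. (U$k$i * U$l$j) * (cayley_density \<kappa> R * (R$3$k * R$3$l)))"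
    if "R \<in> space \<mu>" for R
  proof -
    have R: "R \<in> SO3" using that by (simp add: haar_space[OF haar])
    have 1: "R ** M ** transpose M = R"
      by (simp add: matrix_mul_assoc[symmetric] SO3_inverse[OF M])
    have 2: "diag3 1 1 0 ** (R ** M) ** V = diag3 1 1 0 ** (R ** U)"
      by (simp add: U_def matrix_mul_assoc)
    have 3: "Gram (R ** U) = Gram V"
      using R M by (simp add: U_def Gram_mult_SO3)
    have 4: "(R ** U)$3$i * (R ** U)$3$j = (\<Sum>k\<in>UNIV. \<Sum>l\<in>UNIV. (U$k$i * U$l$j) * (R$3$k * R$3$l))"
      unfolding matrix_matrix_mult_def by (simp add: sum_product mult_ac)
    show ?thesis
      unfolding 1 2 by (simp add: Gram_projection 3 4 right_diff_distrib sum_distrib_left mult_ac)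
  qed
  have "has_bochner_integral \<mu> (\<lambda>R. Gram V $ i $ j * cayley_density \<kappa> R
      - (\<Sum>k\<in>UNIV. \<Sum>l\<in>UNIV. (U$k$i * U$l$j) * (cayley_density \<kappa> R * (R$3$k * R$3$l))))
     (Gram V $ i $ j * 1 - (\<Sum>k\<in>UNIV. \<Sum>l\<in>UNIV. (U$k$i * U$l$j) * S k l))"
    unfolding S_def
    by (intro has_bochner_integral_diff has_bochner_integral_sum has_bochner_integral_mult_right
        cayley_total row_moment kappa haar)
  also have "Gram V $ i $ j * 1 - (\<Sum>k\<in>UNIV. \<Sum>l\<in>UNIV. (U$k$i * U$l$j) * S k l) = ?I"
  proof -
    have "?N > 0" using kappa by (simp add: add_pos_nonneg)
    then show ?thesis
      using kappa unfolding matrix_mul_assoc[symmetric] U_def[symmetric]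
      by (simp add: S_def row_moment_eq[OF kappa haar] sum_3)
        (simp add: Gram_nth D_cayley_def diag3_def matrix_matrix_mult_def sum_3 mult_ac)
  qed
  finally have "has_bochner_integral \<mu> (\<lambda>R. ?F (R ** M)) ?I"
    using F by (simp cong: has_bochner_integral_cong)
  then show ?thesis
    by (rule iffD1[OF haar_integral_mult_right[OF haar M F_measurable]])
qed

lemma cayley_density_0: "cayley_density 0 A = 1"
  by (simp add: cayley_density_def rpow_def Gamma_numeral Gamma_one_half_real)

lemma D_cayley_scalar: "D_cayley 0 = mat (sqrt (1/3))" "D_cayley 1 = mat (sqrt (1/3))"
  by (simp_all add: D_cayley_def diag3_def mat_def vec_eq_iff forall_3)

lemma Gram_scalar:
  fixes W :: "real^'l^3"
  assumes "c \<ge> 0"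
  shows "Gram (mat (sqrt c) ** W) = c *\<^sub>R Gram W"
proof -
  have "mat (sqrt c) ** W = sqrt c *\<^sub>R W"
    by (simp add: vec_eq_iff forall_3 matrix_matrix_mult_def sum_3 mat_def)
  moreover have sq: "sqrt c * (sqrt c * x) = c * x" for x
    using assms by (simp add: mult.assoc[symmetric])
  ultimately show ?thesis
    by (simp add: vec_eq_iff Gram_nth sq algebra_simps)
qed

theorem mainTheorem2:
  fixes \<mu> :: "(real^3^3) measure" and V :: "real^'l^3" and H M :: "real^3^3" and \<kappa> :: real
  assumes haar: "haar_prob_SO3 \<mu>"
    and H: "H = diag3 1 1 0"
    and M: "M \<in> SO3"
    and kappa: "\<kappa> \<ge> 0"
  shows
    "matrix_integrable \<mu> (\<lambda>A. cayley_density \<kappa> (A ** transpose M) *\<^sub>R Gram (H ** A ** V)) \<and>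
     matrix_integral \<mu> (\<lambda>A. cayley_density \<kappa> (A ** transpose M) *\<^sub>R Gram (H ** A ** V))
       = Gram V - Gram (D_cayley \<kappa> ** M ** V) \<and>
     is_scalar_matrix (D_cayley 0) \<and>
     (\<forall>A\<in>SO3. cayley_density 0 A = 1) \<and>
     is_scalar_matrix (D_cayley 1) \<and>
     matrix_integrable \<mu> (\<lambda>A. Gram (H ** A ** V)) \<and>
     matrix_integral \<mu> (\<lambda>A. cayley_density 1 (A ** transpose M) *\<^sub>R Gram (H ** A ** V))
       = matrix_integral \<mu> (\<lambda>A. Gram (H ** A ** V)) \<and>
     matrix_integral \<mu> (\<lambda>A. Gram (H ** A ** V)) = (2/3) *\<^sub>R Gram V"
proof -
  note main = has_bochner_integral_cayley_Gram[OF haar M, where V=V, folded H]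
  have I: "matrix_integrable \<mu> (\<lambda>A. cayley_density k (A ** transpose M) *\<^sub>R Gram (H ** A ** V))"
    and E: "matrix_integral \<mu> (\<lambda>A. cayley_density k (A ** transpose M) *\<^sub>R Gram (H ** A ** V))
       = Gram V - Gram (D_cayley k ** M ** V)" if "k \<ge> 0" for k
    using main[OF that]
    by (simp_all add: matrix_integrable_def matrix_integral_def vec_eq_iff has_bochner_integral_iff)
  have third: "Gram V - Gram (mat (sqrt (1/3)) ** M ** V) = (2/3) *\<^sub>R Gram V"
    unfolding matrix_mul_assoc[symmetric]
    by (simp only: Gram_scalar Gram_mult_SO3[OF M]) (simp add: vec_eq_iff)
  have "is_scalar_matrix (D_cayley 0)" "is_scalar_matrix (D_cayley 1)"
    unfolding is_scalar_matrix_def D_cayley_scalar by blast+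
  then show ?thesis
    using I[OF kappa] E[OF kappa] I[of 0] E[of 0] E[of 1]
    by (simp add: cayley_density_0 D_cayley_scalar third)
qed

end
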